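(* Let $C=\sum_{i=1}^k F_i$ be a pseudo-simple minimal low-degree unmixed $\Sigma\Pi\Sigma\Pi(k)$ circuit of size $s$ over a field $\mathbb{F}$ (with $k\ge 2$). If $C$ computes the zero polynomial, then $\|F_i\|\le s^{5k^2}$ for each $i\in[k]$.
   Context: The field $\mathbb{F}$ is assumed to have sufficiently many elements. A $\Sigma\Pi\Sigma\Pi(k)$ circuit of size $s$ computes a polynomial of the form $C=\sum_{i=1}^k F_i=\sum_{i=1}^k\prod_{j=1}^{d_i} f_{ij}$, where each $f_{ij}$ is a polynomial with at most $s$ monomials given in sparse representation. It is low degree if it computes a polynomial of degree at most $\mathrm{poly}(n)$ in the $n$ variables $x_1,\dots,x_n$. It is unmixed if each $F_i=f_{i1}(x_1)f_{i2}(x_2)\cdots f_{in}(x_n)$ with each $f_{ij}$ a univariate polynomial in $x_j$. For $A\subseteq[k]$, $C_A:=\sum_{i\in A}F_i$; $C$ is minimal if $C_A\not\equiv 0$ for every $\emptyset\subsetneq A\subsetneq[k]$. Pseudo gcd: writing $F_i=\beta_i f_{i1}(x_1)\cdots f_{in}(x_n)$ with each $f_{ij}$ monic, let $S_i=\{f_{i1}(x_1),\dots,f_{in}(x_n)\}$ and $S=\bigcap_i S_i$; $\gcd(F_1,\dots,F_k)_{pseudo}:=\prod_{f\in S}f$. $C$ is pseudo-simple if $\gcd(F_1,\dots,F_k)_{pseudo}=1$. For a polynomial $P$, $\|P\|$ denotes the number of monomials of $P$ with nonzero coefficient. *)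

theory Defs
  imports
    "HOL-Library.Poly_Mapping"
    "HOL-Computational_Algebra.Polynomial"
begin

text \<open>
  Multivariate polynomials over \<open>'a\<close> in the variables \<open>x\<^sub>0, x\<^sub>1, \<dots>\<close>: finitely supported maps from
  exponent vectors to coefficients, with the convolution product of \<^theory>\<open>HOL-Library.Poly_Mapping\<close>.
  Variables and summands are indexed from 0, so \<open>x\<^sub>1, \<dots>, x\<^sub>n\<close> become \<open>x\<^sub>0, \<dots>, x\<^bsub>n-1\<^esub>\<close>.
\<close>

type_synonym 'a mpoly = "(nat \<Rightarrow>\<^sub>0 nat) \<Rightarrow>\<^sub>0 'a"

definition num_monomials :: "'a::zero mpoly \<Rightarrow> nat" where
  "num_monomials P = card (Poly_Mapping.keys P)"

definition total_degree :: "'a::zero mpoly \<Rightarrow> nat" where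
  "total_degree P =
    Max (insert 0 ((\<lambda>m. \<Sum>v\<in>Poly_Mapping.keys m. Poly_Mapping.lookup m v) ` Poly_Mapping.keys P))"

definition const_mpoly :: "'a::zero \<Rightarrow> 'a mpoly" where
  "const_mpoly c = Poly_Mapping.single 0 c"

text \<open>\<open>in_var j g\<close> is the univariate polynomial \<open>g(x\<^sub>j)\<close>.\<close>

definition in_var :: "nat \<Rightarrow> 'a::comm_ring_1 poly \<Rightarrow> 'a mpoly" where
  "in_var j g = (\<Sum>e\<le>degree g. Poly_Mapping.single (Poly_Mapping.single j e) (coeff g e))"

text \<open>
  A \<open>\<Sigma>\<Pi>\<Sigma>\<Pi>(k)\<close> circuit \<open>C\<close> is the list of its \<open>k = length C\<close> summands \<open>F\<^sub>i\<close>, each given by the list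
  of its \<open>d\<^sub>i\<close> factors \<open>f\<^sub>i\<^sub>j\<close>.
\<close>

type_synonym 'a circuit = "'a mpoly list list"

definition summand :: "'a::comm_ring_1 circuit \<Rightarrow> nat \<Rightarrow> 'a mpoly" where
  "summand C i = prod_list (C ! i)"

definition subcircuit_poly :: "'a::comm_ring_1 circuit \<Rightarrow> nat set \<Rightarrow> 'a mpoly" where
  "subcircuit_poly C A = (\<Sum>i\<in>A. summand C i)"

definition circuit_poly :: "'a::comm_ring_1 circuit \<Rightarrow> 'a mpoly" where
  "circuit_poly C = (\<Sum>i<length C. summand C i)"

definition has_size :: "nat \<Rightarrow> 'a::comm_ring_1 circuit \<Rightarrow> bool" where
  "has_size s C \<longleftrightarrow> (\<forall>fs\<in>set C. \<forall>f\<in>set fs. num_monomials f \<le> s)"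

text \<open>The parameter \<open>p\<close> is the polynomial behind the bound \<open>poly(n)\<close>.\<close>

definition low_degree :: "nat poly \<Rightarrow> nat \<Rightarrow> 'a::comm_ring_1 circuit \<Rightarrow> bool" where
  "low_degree p n C \<longleftrightarrow> total_degree (circuit_poly C) \<le> poly p n"

definition unmixed :: "nat \<Rightarrow> 'a::comm_ring_1 circuit \<Rightarrow> bool" where
  "unmixed n C \<longleftrightarrow> (\<forall>fs\<in>set C. length fs = n \<and> (\<forall>j<n. \<exists>g. fs ! j = in_var j g))"

definition minimal_circuit :: "'a::comm_ring_1 circuit \<Rightarrow> bool" where
  "minimal_circuit C \<longleftrightarrow> (\<forall>A. A \<noteq> {} \<and> A \<subset> {..<length C} \<longrightarrow> subcircuit_poly C A \<noteq> 0)"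

text \<open>
  The set \<open>S\<^sub>i\<close> for the factor list \<open>fs\<close> of an unmixed summand \<open>F\<^sub>i\<close>: each nonzero factor is
  uniquely \<open>\<beta> g(x\<^sub>j)\<close> with \<open>\<beta> \<noteq> 0\<close> and \<open>g\<close> monic, and contributes \<open>g(x\<^sub>j)\<close>. The scalar \<open>\<beta>\<^sub>i\<close> is the
  product of these \<open>\<beta>\<close>.
\<close>

definition monic_factors :: "nat \<Rightarrow> 'a::field mpoly list \<Rightarrow> 'a mpoly set" where
  "monic_factors n fs =
    {in_var j g | j g. j < n \<and> lead_coeff g = 1 \<and>
      (\<exists>\<beta>. \<beta> \<noteq> 0 \<and> fs ! j = const_mpoly \<beta> * in_var j g)}"

definition pseudo_gcd :: "nat \<Rightarrow> 'a::field circuit \<Rightarrow> 'a mpoly" where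
  "pseudo_gcd n C = (\<Prod>f\<in>(\<Inter>i<length C. monic_factors n (C ! i)). f)"

definition pseudo_simple :: "nat \<Rightarrow> 'a::field circuit \<Rightarrow> bool" where
  "pseudo_simple n C \<longleftrightarrow> pseudo_gcd n C = 1"

end

theory Submission
  imports Defs "HOL-Library.FuncSet"
begin

text \<open>
  Coefficientwise, an unmixed summand \<open>F\<^sub>i\<close> is the pure tensor of the coefficient sequences of its
  univariate factors. Let \<open>d(a,b)\<close> be the number of variables in which the factors of \<open>F\<^sub>a\<close> and
  \<open>F\<^sub>b\<close> are not proportional. If \<open>d(a,b) \<ge> \<bar>A\<bar> + \<bar>B\<bar> - 1\<close> for all \<open>a \<in> A\<close>, \<open>b \<in> B\<close>, then the spans
  of \<open>(F\<^sub>a)\<close> and \<open>(F\<^sub>b)\<close> intersect trivially. In a minimal zero circuit, every nonempty proper set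
  \<open>X\<close> of summands is therefore joined to its complement by a pair with \<open>d(a,b) \<le> k - 2\<close>. Adding
  summands one by one along such pairs shows that at most \<open>(k - 1)(k - 2)\<close> variables have factors
  that are not all proportional. In every other variable pseudo-simplicity forces the factors to be
  constant, so \<open>\<parallel>F\<^sub>i\<parallel> \<le> s\<^bsup>(k-1)(k-2)\<^esup>\<close>.
\<close>

section \<open>Linear independence of separated families of pure tensors\<close>

text \<open>The zero family is parallel to every family, so transitivity needs a nonzero middle term.\<close>

definition parallel :: "('e \<Rightarrow> 'a::comm_semiring_1) \<Rightarrow> ('e \<Rightarrow> 'a) \<Rightarrow> bool" where
  "parallel u v \<longleftrightarrow> (\<forall>p q. u p * v q = u q * v p)"

lemma sum_fun_upd_factor:
  fixes c :: "'i \<Rightarrow> 'j \<Rightarrow> 'e \<Rightarrow> 'a::comm_ring_1"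
  assumes "finite J" "j \<in> J"
  shows "(\<Sum>a\<in>A. \<alpha> a * (\<Prod>l\<in>J. c a l ((m(j := e)) l)))
    = (\<Sum>a\<in>A. \<alpha> a * c a j e * (\<Prod>l\<in>J - {j}. c a l (m l)))"
proof (rule sum.cong)
  fix a
  have "(\<Prod>l\<in>J. c a l ((m(j := e)) l)) = c a j e * (\<Prod>l\<in>J - {j}. c a l ((m(j := e)) l))"
    by (subst prod.remove[OF assms]) simp
  also have "(\<Prod>l\<in>J - {j}. c a l ((m(j := e)) l)) = (\<Prod>l\<in>J - {j}. c a l (m l))"
    by (rule prod.cong) auto
  finally show "\<alpha> a * (\<Prod>l\<in>J. c a l ((m(j := e)) l)) = \<alpha> a * c a j e * (\<Prod>l\<in>J - {j}. c a l (m l))"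
    by (simp add: mult.assoc)
qed simp

text \<open>The functional sending \<open>u\<close> to \<open>u e * y e' - u e' * y e\<close>,
  applied in variable \<open>j\<close>, turns a sum of tensors over \<open>J\<close> into one over
  \<open>J - {j}\<close> and kills every summand whose factor at \<open>j\<close> is parallel to
  \<open>y\<close>.\<close>

lemma sum_tensor_minor:
  fixes c :: "'i \<Rightarrow> 'j \<Rightarrow> 'e \<Rightarrow> 'a::comm_ring_1"
  assumes "finite J" "j \<in> J"
  shows "(\<Sum>a\<in>A. \<alpha> a * (\<Prod>l\<in>J. c a l ((m(j := e)) l))) * y e'
      - (\<Sum>a\<in>A. \<alpha> a * (\<Prod>l\<in>J. c a l ((m(j := e')) l))) * y e
    = (\<Sum>a\<in>A. \<alpha> a * (c a j e * y e' - c a j e' * y e) * (\<Prod>l\<in>J - {j}. c a l (m l)))"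
  unfolding sum_fun_upd_factor[OF assms] sum_distrib_right sum_subtractf[symmetric]
  by (intro sum.cong refl) (simp add: algebra_simps)

text \<open>A nonzero minor of \<open>x\<close> and \<open>y\<close> at \<open>p\<close>,
  \<open>q\<close> forces \<open>G p = G q = 0\<close>. As \<open>x p\<close> and \<open>x q\<close>
  are not both zero, every other value of \<open>G\<close> vanishes too.\<close>

lemma eq_0_if_parallel_to_nonparallel:
  fixes G :: "'e \<Rightarrow> 'a::idom"
  assumes "parallel G x" "parallel G y" "\<not> parallel x y"
  shows "G e = 0"
proof -
  obtain p q where pq: "x p * y q - x q * y p \<noteq> 0"
    using assms(3) by (auto simp: parallel_def)
  have x: "G p * x q = G q * x p" "G e * x p = G p * x e" "G e * x q = G q * x e"
    using assms(1) by (auto simp: parallel_def)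
  have y: "G p * y q = G q * y p"
    using assms(2) by (auto simp: parallel_def)
  have "G p * (x p * y q - x q * y p) = 0" "G q * (x p * y q - x q * y p) = 0"
    using x(1) y by algebra+
  then have "G p = 0" "G q = 0" using pq by auto
  then have "G e * x p = 0" "G e * x q = 0" using x by auto
  then show ?thesis using pq by auto
qed

text \<open>
  Induction on \<open>\<bar>A\<bar> + \<bar>B\<bar>\<close>: choose \<open>a \<in> A\<close>, \<open>b \<in> B\<close> and a variable \<open>j\<close> in which they are not parallel.
  The functionals in variable \<open>j\<close> that kill \<open>b\<close> remove one summand at the cost of one variable, so by
  induction they kill the common value \<open>G\<close>, which is thus parallel to \<open>b\<close> in direction \<open>j\<close>. By symmetry
  it is also parallel to \<open>a\<close>, hence zero.
\<close>

lemma separated_tensors_independent: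
  fixes c :: "'i \<Rightarrow> 'j \<Rightarrow> 'e \<Rightarrow> 'a::idom"
  assumes "finite A" "finite B" "finite J"
    and "\<And>a b. a \<in> A \<Longrightarrow> b \<in> B \<Longrightarrow>
      card A + card B \<le> Suc (card {j \<in> J. \<not> parallel (c a j) (c b j)})"
    and "\<And>m. (\<Sum>a\<in>A. \<alpha> a * (\<Prod>j\<in>J. c a j (m j)))
      = (\<Sum>b\<in>B. \<beta> b * (\<Prod>j\<in>J. c b j (m j)))"
  shows "(\<Sum>a\<in>A. \<alpha> a * (\<Prod>j\<in>J. c a j (m j))) = 0"
  using assms
proof (induction "card A + card B" arbitrary: A B J \<alpha> \<beta> m rule: less_induct)
  case less
  show ?case
  proof (cases "A = {} \<or> B = {}")
    case True
    then show ?thesis using less.prems(5)[of m] by auto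
  next
    case False
    then obtain a b where ab: "a \<in> A" "b \<in> B" by auto
    then have "card A > 0" "card B > 0" using less.prems by (auto simp: card_gt_0_iff)
    then have "card {j \<in> J. \<not> parallel (c a j) (c b j)} > 0"
      using less.prems(4)[OF ab] by linarith
    then obtain j where j: "j \<in> J" "\<not> parallel (c a j) (c b j)"
      by (auto simp: card_gt_0_iff)
    have dist: "card {l \<in> J. \<not> parallel (c a' l) (c b' l)}
        \<le> Suc (card {l \<in> J - {j}. \<not> parallel (c a' l) (c b' l)})" for a' b'
    proof -
      have "card {l \<in> J. \<not> parallel (c a' l) (c b' l)}
          \<le> card (insert j {l \<in> J - {j}. \<not> parallel (c a' l) (c b' l)})"
        using less.prems(3) by (intro card_mono) auto
      then show ?thesis
        using less.prems(3) by (simp add: card_insert_if split: if_splits)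
    qed
    \<comment> \<open>The common value of both sums as a function of the exponent of variable
      \<open>j\<close>; the other exponents stay fixed by \<open>m\<close>.\<close>
    define G where "G e = (\<Sum>a\<in>A. \<alpha> a * (\<Prod>l\<in>J. c a l ((m(j := e)) l)))" for e
    have cards: "card (A - {a}) + card B < card A + card B" "card A + card (B - {b}) < card A + card B"
      using ab less.prems(1,2) card_gt_0_iff[of A] card_gt_0_iff[of B] by auto
    have minor: "(\<Sum>a\<in>A. \<alpha> a * (c a j p * y q - c a j q * y p) * (\<Prod>l\<in>J - {j}. c a l (m' l)))
      = (\<Sum>b\<in>B. \<beta> b * (c b j p * y q - c b j q * y p) * (\<Prod>l\<in>J - {j}. c b l (m' l)))" for y m' p q
      unfolding sum_tensor_minor[OF less.prems(3) j(1), symmetric] by (simp only: less.prems(5))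
    have "parallel G (c b j)"
      unfolding parallel_def
    proof (intro allI)
      fix p q
      \<comment> \<open>With this \<open>?y\<close> the weight of \<open>b\<close> is zero, so the
        right-hand sum effectively runs over \<open>B - {b}\<close>.\<close>
      let ?y = "c b j"
      have "(\<Sum>a\<in>A. \<alpha> a * (c a j p * ?y q - c a j q * ?y p) * (\<Prod>l\<in>J - {j}. c a l (m l))) = 0"
      proof (rule less.hyps[OF cards(2), where \<beta> = "\<lambda>b. \<beta> b * (c b j p * ?y q - c b j q * ?y p)"])
        fix a' b' assume "a' \<in> A" "b' \<in> B - {b}"
        then show "card A + card (B - {b}) \<le> Suc (card {l \<in> J - {j}. \<not> parallel (c a' l) (c b' l)})"
          using less.prems(4)[of a' b'] dist[of a' b'] cards(2) by auto
      qed (use less.prems ab in \<open>auto simp: minor sum.remove[of B b]\<close>)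
      then show "G p * c b j q = G q * c b j p"
        unfolding sum_tensor_minor[OF less.prems(3) j(1), symmetric] G_def by simp
    qed
    moreover have "parallel G (c a j)"
      unfolding parallel_def
    proof (intro allI)
      fix p q
      let ?y = "c a j"
      have "(\<Sum>a\<in>A - {a}. \<alpha> a * (c a j p * ?y q - c a j q * ?y p)
          * (\<Prod>l\<in>J - {j}. c a l (m l))) = 0"
      proof (rule less.hyps[OF cards(1), where \<beta> = "\<lambda>b. \<beta> b * (c b j p * ?y q - c b j q * ?y p)"])
        fix a' b' assume "a' \<in> A - {a}" "b' \<in> B"
        then show "card (A - {a}) + card B \<le> Suc (card {l \<in> J - {j}. \<not> parallel (c a' l) (c b' l)})"
          using less.prems(4)[of a' b'] dist[of a' b'] cards(1) by auto
      qed (use less.prems ab in \<open>auto simp: minor[symmetric] sum.remove[of A a]\<close>)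
      \<comment> \<open>Here the left-hand sum lost \<open>a\<close>; its weight is zero, so it can
        be put back.\<close>
      then have "(\<Sum>a\<in>A. \<alpha> a * (c a j p * ?y q - c a j q * ?y p) * (\<Prod>l\<in>J - {j}. c a l (m l))) = 0"
        using ab less.prems(1) by (simp add: sum.remove[of A a])
      then show "G p * c a j q = G q * c a j p"
        unfolding sum_tensor_minor[OF less.prems(3) j(1), symmetric] G_def by simp
    qed
    \<comment> \<open>Setting the exponent of \<open>j\<close> to \<open>m j\<close> leaves
      \<open>m\<close> unchanged, so this is the required value.\<close>
    ultimately have "G (m j) = 0"
      using eq_0_if_parallel_to_nonparallel[OF _ _ j(2)] by simp
    then show ?thesis by (simp add: G_def)
  qed
qed


section \<open>Active variables of a minimal tensor relation\<close>

lemma parallel_refl [simp]: "parallel u u"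
  by (simp add: parallel_def mult.commute)

lemma parallel_sym: "parallel u v \<Longrightarrow> parallel v u"
  by (simp add: parallel_def mult.commute)

lemma parallel_trans:
  fixes u v w :: "'e \<Rightarrow> 'a::idom"
  assumes "parallel u v" "parallel v w" "v r \<noteq> 0"
  shows "parallel u w"
  unfolding parallel_def
proof (intro allI)
  fix p q
  have "u p * v r = u r * v p" "u q * v r = u r * v q" "v p * w q = v q * w p"
    using assms(1,2) by (auto simp: parallel_def)
  then have "v r * (u p * w q - u q * w p) = 0" by algebra
  then show "u p * w q = u q * w p" using assms(3) by simp
qed

lemma minimal_tensor_relation_bound:
  fixes c :: "'i \<Rightarrow> 'j \<Rightarrow> 'e \<Rightarrow> 'a::idom"
  assumes fin: "finite I" "finite J" and "I \<noteq> {}"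
    and nz: "\<And>i j. i \<in> I \<Longrightarrow> j \<in> J \<Longrightarrow> \<exists>e. c i j e \<noteq> 0"
    and zero: "\<And>m. (\<Sum>i\<in>I. \<Prod>j\<in>J. c i j (m j)) = 0"
    and minimal: "\<And>A. A \<noteq> {} \<Longrightarrow> A \<subset> I \<Longrightarrow> \<exists>m. (\<Sum>i\<in>A. \<Prod>j\<in>J. c i j (m j)) \<noteq> 0"
  shows "card {j \<in> J. \<exists>a\<in>I. \<exists>b\<in>I. \<not> parallel (c a j) (c b j)} \<le> (card I - 1) * (card I - 2)"
proof -
  define active where "active X = {j \<in> J. \<exists>a\<in>X. \<exists>b\<in>X. \<not> parallel (c a j) (c b j)}" for X
  \<comment> \<open>A single index has no active variables; each of the \<open>m\<close> further
    indices adds at most \<open>card I - 2\<close>.\<close>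
  have "\<exists>X\<subseteq>I. card X = Suc m \<and> card (active X) \<le> m * (card I - 2)" if "Suc m \<le> card I" for m
    using that
  proof (induction m)
    case 0
    obtain i where "i \<in> I" using \<open>I \<noteq> {}\<close> by blast
    then show ?case by (intro exI[of _ "{i}"]) (auto simp: active_def)
  next
    case (Suc m)
    then obtain X where X: "X \<subseteq> I" "card X = Suc m" "card (active X) \<le> m * (card I - 2)"
      by auto
    have "X \<noteq> {}" "X \<subset> I" using X Suc.prems by auto
    then obtain m0 where m0: "(\<Sum>i\<in>X. \<Prod>j\<in>J. c i j (m0 j)) \<noteq> 0"
      using minimal by blast
    have finX: "finite X" using X fin finite_subset by blast
    \<comment> \<open>\<open>X\<close> and its complement, the latter weighted by -1, give the same
      tensor. It is nonzero at \<open>m0\<close>, so the two sides cannot be separated.\<close>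
    have "(\<Sum>i\<in>X. 1 * (\<Prod>j\<in>J. c i j (m j))) = (\<Sum>i\<in>I - X. - 1 * (\<Prod>j\<in>J. c i j (m j)))" for m
      using zero[of m] sum.subset_diff[OF X(1) fin(1), of "\<lambda>i. \<Prod>j\<in>J. c i j (m j)"]
      by (simp add: sum_negf eq_neg_iff_add_eq_0 add.commute)
    from separated_tensors_independent[OF finX finite_Diff[OF fin(1)] fin(2) _ this]
    obtain a b where ab: "a \<in> X" "b \<in> I - X"
      "\<not> card X + card (I - X) \<le> Suc (card {j \<in> J. \<not> parallel (c a j) (c b j)})"
      using m0 by fastforce
    moreover have "card X + card (I - X) = card I"
      using X(1) fin(1) by (simp add: card_Diff_subset card_mono finX)
    ultimately have d: "card {j \<in> J. \<not> parallel (c a j) (c b j)} \<le> card I - 2" by linarith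
    \<comment> \<open>At any other \<open>j\<close> all factors from \<open>insert b X\<close> are
      parallel to \<open>c a j\<close>, which is nonzero by \<open>nz\<close>, so transitivity
      applies.\<close>
    have "active (insert b X) \<subseteq> active X \<union> {j \<in> J. \<not> parallel (c a j) (c b j)}"
    proof
      fix j assume "j \<in> active (insert b X)"
      then obtain x y where xy: "x \<in> insert b X" "y \<in> insert b X" "\<not> parallel (c x j) (c y j)"
        and j: "j \<in> J" by (auto simp: active_def)
      obtain r where r: "c a j r \<noteq> 0" using nz[of a j] X ab(1) j by auto
      show "j \<in> active X \<union> {j \<in> J. \<not> parallel (c a j) (c b j)}"
      proof (rule ccontr)
        assume "\<not> ?thesis"
        then have *: "parallel (c x j) (c a j)" if "x \<in> insert b X" for x
          using that ab(1) j by (auto simp: active_def intro: parallel_sym)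
        then have "parallel (c x j) (c y j)"
          using parallel_trans[OF *[OF xy(1)] parallel_sym[OF *[OF xy(2)]] r] by simp
        then show False using xy by simp
      qed
    qed
    then have "card (active (insert b X)) \<le> card (active X \<union> {j \<in> J. \<not> parallel (c a j) (c b j)})"
      using fin(2) by (intro card_mono) (auto simp: active_def)
    also have "\<dots> \<le> card (active X) + card {j \<in> J. \<not> parallel (c a j) (c b j)}"
      by (rule card_Un_le)
    also have "\<dots> \<le> Suc m * (card I - 2)" using X(3) d by simp
    finally show ?case
      using ab X finX by (intro exI[of _ "insert b X"]) auto
  qed
  from this[of "card I - 1"] obtain X where "X \<subseteq> I" "card X = card I"
    "card (active X) \<le> (card I - 1) * (card I - 2)"
    using \<open>I \<noteq> {}\<close> fin(1) by (auto simp: Suc_diff_le card_gt_0_iff Suc_le_eq)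
  then show ?thesis
    using card_subset_eq[OF fin(1)] by (auto simp: active_def)
qed

section \<open>Coefficients of products of univariate polynomials\<close>

abbreviation monomial_of :: "nat set \<Rightarrow> (nat \<Rightarrow> nat) \<Rightarrow> (nat \<Rightarrow>\<^sub>0 nat)" where
  "monomial_of J f \<equiv> (\<Sum>j\<in>J. Poly_Mapping.single j (f j))"

lemma lookup_monomial_of:
  "finite J \<Longrightarrow> Poly_Mapping.lookup (monomial_of J f) j = (if j \<in> J then f j else 0)"
  by (simp add: lookup_sum lookup_single when_def)

lemma monomial_of_eq_iff:
  assumes "finite J"
  shows "monomial_of J f = monomial_of J g \<longleftrightarrow> (\<forall>j\<in>J. f j = g j)"
proof
  assume "monomial_of J f = monomial_of J g"
  then show "\<forall>j\<in>J. f j = g j"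
    using lookup_monomial_of[OF assms] by metis
qed simp

lemma prod_single:
  fixes c :: "'j \<Rightarrow> 'a::comm_semiring_1"
  shows "(\<Prod>j\<in>J. Poly_Mapping.single (t j) (c j)) = Poly_Mapping.single (\<Sum>j\<in>J. t j) (\<Prod>j\<in>J. c j)"
  by (induction J rule: infinite_finite_induct) (simp_all add: mult_single)

lemma prod_in_var:
  fixes h :: "nat \<Rightarrow> 'a::comm_ring_1 poly"
  assumes "finite J"
  shows "(\<Prod>j\<in>J. in_var j (h j)) = (\<Sum>f\<in>PiE J (\<lambda>j. {..degree (h j)}).
    Poly_Mapping.single (monomial_of J f) (\<Prod>j\<in>J. coeff (h j) (f j)))"
  unfolding in_var_def using assms by (simp add: prod_sum_PiE prod_single)

text \<open>Extensional exponent functions on \<open>J\<close> give distinct monomials, so at most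
  one term of the expansion contributes. If \<open>f\<close> exceeds some degree, none does and the
  right-hand product has a zero factor.\<close>

lemma lookup_prod_in_var:
  fixes h :: "nat \<Rightarrow> 'a::comm_ring_1 poly"
  assumes J: "finite J"
  shows "Poly_Mapping.lookup (\<Prod>j\<in>J. in_var j (h j)) (monomial_of J f)
    = (\<Prod>j\<in>J. coeff (h j) (f j))"
proof -
  let ?P = "PiE J (\<lambda>j. {..degree (h j)})"
  have eq: "monomial_of J g = monomial_of J f \<longleftrightarrow> g = restrict f J" if "g \<in> ?P" for g
    unfolding monomial_of_eq_iff[OF J] using that by (auto simp: PiE_iff extensional_def restrict_def)
  have "Poly_Mapping.lookup (\<Prod>j\<in>J. in_var j (h j)) (monomial_of J f)
      = (\<Sum>g\<in>?P. if g = restrict f J then \<Prod>j\<in>J. coeff (h j) (g j) else 0)"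
    unfolding prod_in_var[OF J] lookup_sum
    by (intro sum.cong refl) (simp add: lookup_single when_def eq)
  also have "\<dots> = (if restrict f J \<in> ?P then \<Prod>j\<in>J. coeff (h j) (f j) else 0)"
    using J by (simp add: finite_PiE)
  also have "\<dots> = (\<Prod>j\<in>J. coeff (h j) (f j))"
  proof (cases "restrict f J \<in> ?P")
    case False
    then have "\<exists>j\<in>J. degree (h j) < f j" by (auto simp: Pi_iff not_le)
    then obtain j where "j \<in> J" "degree (h j) < f j" by blast
    then have "(\<Prod>j\<in>J. coeff (h j) (f j)) = 0"
      using J by (intro prod_zero) (auto intro: coeff_eq_0)
    then show ?thesis using False by simp
  qed simp
  finally show ?thesis .
qed

lemma keys_prod_in_var:
  fixes h :: "nat \<Rightarrow> 'a::comm_ring_1 poly"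
  assumes "finite J" "Poly_Mapping.lookup (\<Prod>j\<in>J. in_var j (h j)) m \<noteq> 0"
  shows "\<exists>f. m = monomial_of J f"
proof -
  obtain f where "Poly_Mapping.lookup
      (Poly_Mapping.single (monomial_of J f) (\<Prod>j\<in>J. coeff (h j) (f j))) m \<noteq> 0"
    using assms(2) unfolding prod_in_var[OF assms(1)] lookup_sum
    by (meson sum.not_neutral_contains_not_neutral)
  then have "m = monomial_of J f" by (simp add: lookup_single when_def split: if_splits)
  then show ?thesis by blast
qed

text \<open>The passage between polynomial identities and tensor relations: monomials other than the
  \<open>monomial_of J f\<close> occur in none of the products.\<close>

lemma sum_prod_in_var_eq_0_iff:
  fixes h :: "'i \<Rightarrow> nat \<Rightarrow> 'a::comm_ring_1 poly"
  assumes "finite J"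
  shows "(\<Sum>i\<in>A. \<Prod>j\<in>J. in_var j (h i j)) = 0
    \<longleftrightarrow> (\<forall>f. (\<Sum>i\<in>A. \<Prod>j\<in>J. coeff (h i j) (f j)) = 0)" (is "?P = 0 \<longleftrightarrow> ?R")
proof
  have *: "Poly_Mapping.lookup ?P (monomial_of J f) = (\<Sum>i\<in>A. \<Prod>j\<in>J. coeff (h i j) (f j))" for f
    by (simp add: lookup_sum[of _ A] lookup_prod_in_var[OF assms])
  show "?P = 0 \<Longrightarrow> ?R" by (simp flip: *)
  assume R: ?R
  show "?P = 0"
  proof (rule poly_mapping_eqI)
    fix m
    show "Poly_Mapping.lookup ?P m = Poly_Mapping.lookup 0 m"
    proof (cases "\<exists>f. m = monomial_of J f")
      case True
      then show ?thesis using R * by auto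
    next
      case False
      then have "Poly_Mapping.lookup (\<Prod>j\<in>J. in_var j (h i j)) m = 0" for i
        using keys_prod_in_var[OF assms] by blast
      then show ?thesis by (simp add: lookup_sum)
    qed
  qed
qed

lemma lookup_in_var: "Poly_Mapping.lookup (in_var j g) (Poly_Mapping.single j e) = coeff g e"
  using lookup_prod_in_var[of "{j}" "\<lambda>_. g" "\<lambda>_. e"] by simp

lemma in_var_eq_iff [simp]: "in_var j g = in_var j h \<longleftrightarrow> g = h"
  by (metis lookup_in_var poly_eqI)

lemma in_var_0 [simp]: "in_var j 0 = 0"
  by (simp add: in_var_def)

lemma in_var_const: "in_var j [:a:] = Poly_Mapping.single 0 a"
  by (simp add: in_var_def)

lemma in_var_smult:
  fixes \<beta> :: "'a::field"
  shows "in_var j (smult \<beta> g) = const_mpoly \<beta> * in_var j g"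
  by (cases "\<beta> = 0") (simp_all add: in_var_def const_mpoly_def sum_distrib_left mult_single)

text \<open>If \<open>degree g\<close> were positive, the leading monomial of
  \<open>in_var i g\<close> would involve variable \<open>i\<close> and could not occur in
  \<open>in_var j h\<close>.\<close>

lemma in_var_eq_different_var:
  assumes "in_var i g = in_var j h" "i \<noteq> j"
  shows "degree g = 0"
proof (rule ccontr)
  assume "degree g \<noteq> 0"
  then have "Poly_Mapping.lookup (in_var j h) (Poly_Mapping.single i (degree g)) \<noteq> 0"
    using assms(1)[symmetric] by (simp add: lookup_in_var leading_coeff_0_iff) auto
  then obtain f where f: "Poly_Mapping.single i (degree g) = monomial_of {j} f"
    using keys_prod_in_var[of "{j}" "\<lambda>_. h"] by auto
  then have "degree g = Poly_Mapping.lookup (Poly_Mapping.single j (f j)) i"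
    by (metis (no_types, lifting) lookup_single_eq sum.insert sum.empty finite.emptyI empty_iff add_0_right)
  then show False using assms(2) \<open>degree g \<noteq> 0\<close> by (simp add: lookup_single)
qed

lemma monic_in_var_eq_1:
  assumes "degree g = 0" "lead_coeff g = (1::'a::comm_ring_1)"
  shows "in_var j g = 1"
proof -
  have "g = [:1:]" using assms by (metis degree_0_id)
  then show ?thesis by (simp add: in_var_const)
qed

section \<open>Counting monomials of products\<close>

lemma num_monomials_mult:
  fixes P Q :: "'a::comm_ring_1 mpoly"
  shows "num_monomials (P * Q) \<le> num_monomials P * num_monomials Q"
proof -
  have "Poly_Mapping.keys (P * Q) \<subseteq> (\<lambda>(a, b). a + b) ` (Poly_Mapping.keys P \<times> Poly_Mapping.keys Q)"
    using keys_mult[of P Q] by auto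
  then have "num_monomials (P * Q) \<le> card (Poly_Mapping.keys P \<times> Poly_Mapping.keys Q)"
    unfolding num_monomials_def by (rule surj_card_le[rotated]) simp
  then show ?thesis by (simp add: num_monomials_def card_cartesian_product)
qed

lemma num_monomials_prod:
  fixes P :: "'j \<Rightarrow> 'a::comm_ring_1 mpoly"
  shows "num_monomials (\<Prod>j\<in>J. P j) \<le> (\<Prod>j\<in>J. num_monomials (P j))"
proof (induction J rule: infinite_finite_induct)
  case (insert j J)
  have "num_monomials (\<Prod>j\<in>insert j J. P j) \<le> num_monomials (P j) * num_monomials (\<Prod>j\<in>J. P j)"
    using insert num_monomials_mult by simp
  also have "\<dots> \<le> (\<Prod>j\<in>insert j J. num_monomials (P j))"
    using insert by simp
  finally show ?case .
qed (simp_all add: num_monomials_def)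

section \<open>Proportional polynomials, monic parts and the pseudo gcd\<close>

lemma parallel_coeff_iff:
  fixes f g :: "'a::field poly"
  assumes "f \<noteq> 0" "g \<noteq> 0"
  shows "parallel (coeff f) (coeff g) \<longleftrightarrow> (\<exists>\<beta>. \<beta> \<noteq> 0 \<and> f = smult \<beta> g)"
proof
  assume par: "parallel (coeff f) (coeff g)"
  \<comment> \<open>The proportionality relation at index \<open>degree g\<close> determines the
    scalar.\<close>
  define \<beta> where "\<beta> = coeff f (degree g) / lead_coeff g"
  have f: "f = smult \<beta> g"
  proof (rule poly_eqI)
    fix e
    have "coeff f (degree g) * coeff g e = coeff f e * lead_coeff g"
      using par by (simp add: parallel_def)
    then show "coeff f e = coeff (smult \<beta> g) e"
      using assms by (simp add: \<beta>_def field_simps)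
  qed
  with assms have "\<beta> \<noteq> 0" by auto
  with f show "\<exists>\<beta>. \<beta> \<noteq> 0 \<and> f = smult \<beta> g" by blast
qed (auto simp: parallel_def)

text \<open>The canonical representative of a nonzero polynomial up to scalars; it turns parallelism
  into equality.\<close>

definition monic_part :: "'a::field poly \<Rightarrow> 'a poly" where
  "monic_part f = smult (inverse (lead_coeff f)) f"

lemma lead_coeff_monic_part: "f \<noteq> 0 \<Longrightarrow> lead_coeff (monic_part f) = 1"
  by (simp add: monic_part_def)

lemma degree_monic_part [simp]: "degree (monic_part f) = degree f"
  by (cases "f = 0") (simp_all add: monic_part_def)

lemma monic_part_smult: "\<beta> \<noteq> 0 \<Longrightarrow> monic_part (smult \<beta> g) = monic_part g"
  by (simp add: monic_part_def field_simps)

lemma monic_part_monic: "lead_coeff g = 1 \<Longrightarrow> monic_part g = g"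
  by (simp add: monic_part_def)

lemma smult_monic_part: "smult (lead_coeff f) (monic_part f) = f"
  by (cases "f = 0") (simp_all add: monic_part_def)

text \<open>A nonzero polynomial is a scalar multiple of only one monic polynomial, so the
  existential in \<open>monic_factors\<close> leaves no choice.\<close>

lemma monic_factors_in_var:
  assumes "\<And>j. j < n \<Longrightarrow> fs ! j = in_var j (h j)" "\<And>j. j < n \<Longrightarrow> h j \<noteq> 0"
  shows "monic_factors n fs = {in_var j (monic_part (h j)) | j. j < n}"
proof (intro equalityI subsetI)
  fix f assume "f \<in> monic_factors n fs"
  then obtain j g \<beta> where *: "f = in_var j g" "j < n" "lead_coeff g = 1" "\<beta> \<noteq> 0"
    "fs ! j = const_mpoly \<beta> * in_var j g" by (auto simp: monic_factors_def)
  then have "h j = smult \<beta> g" using assms(1) by (simp flip: in_var_smult)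
  then show "f \<in> {in_var j (monic_part (h j)) | j. j < n}"
    using * by (intro CollectI exI[of _ j]) (simp add: monic_part_smult monic_part_monic)
next
  fix f assume "f \<in> {in_var j (monic_part (h j)) | j. j < n}"
  then obtain j where "j < n" "f = in_var j (monic_part (h j))" by auto
  moreover have "fs ! j = const_mpoly (lead_coeff (h j)) * in_var j (monic_part (h j))"
    using assms \<open>j < n\<close> by (simp flip: in_var_smult add: smult_monic_part)
  ultimately show "f \<in> monic_factors n fs"
    unfolding monic_factors_def using assms(2) lead_coeff_monic_part leading_coeff_0_iff by blast
qed

lemma parallel_iff_monic_part:
  fixes f g :: "'a::field poly"
  assumes "f \<noteq> 0" "g \<noteq> 0"
  shows "parallel (coeff f) (coeff g) \<longleftrightarrow> monic_part f = monic_part g"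
proof
  assume "monic_part f = monic_part g"
  then have "f = smult (lead_coeff f / lead_coeff g) g"
    using assms by (metis monic_part_def smult_monic_part smult_smult divide_inverse)
  moreover have "lead_coeff f / lead_coeff g \<noteq> 0" using assms by simp
  ultimately show "parallel (coeff f) (coeff g)" using parallel_coeff_iff[OF assms] by blast
qed (auto simp: parallel_coeff_iff[OF assms] monic_part_smult)

text \<open>Up to factors 1, the pseudo gcd is the product of the monic parts that all summands
  share in the same variable. Its top coefficient is 1, so it equals 1 only if all these parts are
  constant.\<close>

lemma pseudo_simple_common_factor:
  assumes "pseudo_simple n C" "0 < length C"
    and C: "\<And>i j. i < length C \<Longrightarrow> j < n \<Longrightarrow> C ! i ! j = in_var j (h i j)"
    and nz: "\<And>i j. i < length C \<Longrightarrow> j < n \<Longrightarrow> h i j \<noteq> 0"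
    and "j < n" and par: "\<And>i. i < length C \<Longrightarrow> monic_part (h i j) = monic_part (h 0 j)"
  shows "degree (h 0 j) = 0"
proof -
  let ?g = "\<lambda>j. monic_part (h 0 j)"
  define T where "T = {j. j < n \<and> (\<forall>i<length C. monic_part (h i j) = ?g j)}"
  let ?S = "\<Inter>i<length C. monic_factors n (C ! i)"
  have S_i: "monic_factors n (C ! i) = {in_var j (monic_part (h i j)) | j. j < n}"
    if "i < length C" for i
    using C nz that by (intro monic_factors_in_var) auto
  then have S: "?S = (\<Inter>i<length C. {in_var j (monic_part (h i j)) | j. j < n})"
    by (intro INF_cong refl) simp
  have T: "(\<lambda>j. in_var j (?g j)) ` T \<subseteq> ?S"
  proof clarify
    fix i j assume "j \<in> T" "i < length C"
    then have "j < n" "monic_part (h i j) = ?g j" by (auto simp: T_def)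
    then show "in_var j (?g j) \<in> monic_factors n (C ! i)"
      using S_i[OF \<open>i < length C\<close>] by (metis (mono_tags, lifting) mem_Collect_eq)
  qed
  \<comment> \<open>The constant 1 may stem from different variables in different summands; a
    nonconstant factor determines its variable.\<close>
  have ST: "f \<in> (\<lambda>j. in_var j (?g j)) ` T" if f: "f \<in> ?S" and "f \<noteq> 1" for f
  proof -
    obtain j where j: "j < n" "f = in_var j (?g j)"
      using f assms(2) unfolding S by auto
    have deg: "degree (?g j) \<noteq> 0"
      using monic_in_var_eq_1[OF _ lead_coeff_monic_part[OF nz], of 0 j j] assms(2) j \<open>f \<noteq> 1\<close> by auto
    have "monic_part (h i j) = ?g j" if "i < length C" for i
    proof -
      obtain j' where j': "f = in_var j' (monic_part (h i j'))"
        using f \<open>i < length C\<close> unfolding S by auto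
      then have "j' = j" using in_var_eq_different_var[of j "?g j"] j deg by metis
      then show ?thesis using j j' by simp
    qed
    then have "j \<in> T" using j by (simp add: T_def)
    then show ?thesis using j by blast
  qed
  have finT: "finite T" by (simp add: T_def)
  have h0: "h 0 i \<noteq> 0" if "i \<in> T" for i
    using that nz assms(2) unfolding T_def by blast
  \<comment> \<open>A product over an infinite set is 1 by convention, so finiteness is settled
    before products are compared.\<close>
  have "?S \<subseteq> insert 1 ((\<lambda>j. in_var j (?g j)) ` T)"
    using ST by (intro subsetI) (metis insert_iff)
  then have finS: "finite ?S" by (rule finite_subset) (simp add: finT)
  \<comment> \<open>Images for different variables coincide only if they equal 1, so merging them
    does not change the product.\<close>
  have "(\<Prod>f\<in>(\<lambda>j. in_var j (?g j)) ` T. f) = prod ((\<lambda>f. f) \<circ> (\<lambda>j. in_var j (?g j))) T"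
  proof (rule prod.reindex_nontrivial[where h = "\<lambda>j. in_var j (?g j)", OF finT])
    fix i j assume *: "i \<in> T" "j \<in> T" "i \<noteq> j" "in_var i (?g i) = in_var j (?g j)"
    then show "in_var i (?g i) = 1"
      by (intro monic_in_var_eq_1[OF in_var_eq_different_var[OF *(4,3)] lead_coeff_monic_part] h0)
  qed
  then have "(\<Prod>j\<in>T. in_var j (?g j)) = (\<Prod>f\<in>(\<lambda>j. in_var j (?g j)) ` T. f)"
    by (simp only: comp_def)
  also have "\<dots> = (\<Prod>f\<in>?S. f)"
    using ST by (intro prod.mono_neutral_left finS T) auto
  also have "\<dots> = 1" using assms(1) by (simp add: pseudo_simple_def pseudo_gcd_def)
  \<comment> \<open>Coefficients are compared at the product of the leading monomials; in the
    polynomial 1 only the zero exponent vector has a nonzero one.\<close>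
  finally have "Poly_Mapping.lookup 1 (monomial_of T (\<lambda>j. degree (?g j)))
      = (\<Prod>j\<in>T. lead_coeff (?g j))"
    using lookup_prod_in_var[OF finT, of ?g] by metis
  also have "\<dots> = 1"
    by (intro prod.neutral ballI lead_coeff_monic_part h0)
  finally have "monomial_of T (\<lambda>j. degree (?g j)) = 0"
    by (auto simp: lookup_one when_def split: if_splits)
  moreover have "j \<in> T" using assms(5) par by (simp add: T_def)
  ultimately show ?thesis
    using lookup_monomial_of[OF finT, of "\<lambda>j. degree (?g j)" j] by simp
qed

section \<open>The monomial bound for unmixed circuits\<close>

theorem theorem3p1:
  fixes C :: "'a::field circuit" and n k s :: nat and p :: "nat poly"
  assumes "length C = k" and "k \<ge> 2" and "s \<ge> 1"
    and "has_size s C"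
    and "low_degree p n C"
    and "unmixed n C"
    and "minimal_circuit C"
    and "pseudo_simple n C"
    and "circuit_poly C = 0"
  shows "\<forall>i<k. num_monomials (summand C i) \<le> s ^ (5 * k\<^sup>2)"
proof (intro allI impI)
  fix i0 assume i0: "i0 < k"
  have len: "length (C ! i) = n" if "i < k" for i
    using assms(1,6) that by (simp add: unmixed_def)
  have "\<exists>h. \<forall>i<k. \<forall>j<n. C ! i ! j = in_var j (h i j)"
    using assms(1,6) by (simp add: unmixed_def all_set_conv_all_nth) metis
  then obtain h where h: "\<And>i j. i < k \<Longrightarrow> j < n \<Longrightarrow> C ! i ! j = in_var j (h i j)" by blast
  have summand: "summand C i = (\<Prod>j<n. in_var j (h i j))" if "i < k" for i
    unfolding summand_def prod.list_conv_set_nth len[OF that] atLeast0LessThan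
    using h that by (intro prod.cong) auto
  have sub: "subcircuit_poly C A = (\<Sum>i\<in>A. \<Prod>j<n. in_var j (h i j))" if "A \<subseteq> {..<k}" for A
    unfolding subcircuit_poly_def using that summand by (intro sum.cong) auto
  have "summand C i \<noteq> 0" if "i < k" for i
  proof -
    \<comment> \<open>As \<open>k \<ge> 2\<close>, singletons are proper subsets and minimality
      applies to them.\<close>
    have "card {i} < card {..<k}" using assms(2) by simp
    then have "{i} \<subset> {..<length C}"
      using that assms(1) by (metis lessThan_iff empty_subsetI insert_subset psubsetI nat_less_le)
    then have "subcircuit_poly C {i} \<noteq> 0" using assms(7) by (auto simp: minimal_circuit_def)
    then show ?thesis by (simp add: subcircuit_poly_def)
  qed
  then have nz: "h i j \<noteq> 0" if "i < k" "j < n" for i j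
    using that summand by (metis in_var_0 finite_lessThan lessThan_iff prod_zero)
  let ?c = "\<lambda>i j. coeff (h i j)"
  define act where "act = {j \<in> {..<n}. \<exists>a\<in>{..<k}. \<exists>b\<in>{..<k}. \<not> parallel (?c a j) (?c b j)}"
  have "card act \<le> (card {..<k} - 1) * (card {..<k} - 2)"
    unfolding act_def
  proof (rule minimal_tensor_relation_bound)
    show "{..<k} \<noteq> {}" using i0 by auto
    show "\<exists>e. ?c i j e \<noteq> 0" if "i \<in> {..<k}" "j \<in> {..<n}" for i j
      using nz[of i j] that leading_coeff_0_iff by blast
    have "subcircuit_poly C {..<k} = 0"
      using assms(1,9) by (simp add: circuit_poly_def subcircuit_poly_def)
    then show "(\<Sum>i<k. \<Prod>j<n. ?c i j (m j)) = 0" for m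
      by (simp add: sub sum_prod_in_var_eq_0_iff)
    show "\<exists>m. (\<Sum>i\<in>A. \<Prod>j<n. ?c i j (m j)) \<noteq> 0" if "A \<noteq> {}" "A \<subset> {..<k}" for A
    proof -
      have "subcircuit_poly C A \<noteq> 0" using assms(1,7) that by (simp add: minimal_circuit_def)
      then show ?thesis using that by (simp add: sub psubset_imp_subset sum_prod_in_var_eq_0_iff)
    qed
  qed simp_all
  \<comment> \<open>A crude estimate suffices: \<open>(k - 1) * (k - 2) \<le> k * k\<close>.\<close>
  also have "\<dots> \<le> 5 * k\<^sup>2"
    using mult_le_mono[of "k - 1" k "k - 2" k] by (simp add: power2_eq_square)
  finally have act: "card act \<le> 5 * k\<^sup>2" .
  \<comment> \<open>In an active variable the size bounds the factor. In any other, all summands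
    agree up to scalars and pseudo-simplicity makes the factor constant.\<close>
  have factor: "num_monomials (in_var j (h i0 j)) \<le> (if j \<in> act then s else 1)" if "j < n" for j
  proof (cases "j \<in> act")
    case True
    have "C ! i0 ! j \<in> set (C ! i0)" "C ! i0 \<in> set C"
      using len i0 that assms(1) by auto
    then have "num_monomials (C ! i0 ! j) \<le> s" using assms(4) by (auto simp: has_size_def)
    then show ?thesis using True h i0 that by simp
  next
    case False
    then have par: "monic_part (h i j) = monic_part (h 0 j)" if "i < k" for i
      using that \<open>j < n\<close> i0 nz by (subst parallel_iff_monic_part[symmetric]) (auto simp: act_def)
    have "degree (h 0 j) = 0"
    proof (rule pseudo_simple_common_factor[OF assms(8), of h j])
      show "0 < length C" using assms(1) i0 by simp
    qed (use h nz par that assms(1) in blast)+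
    then have "degree (h i0 j) = 0"
      using par[OF i0] degree_monic_part by metis
    then obtain a where "h i0 j = [:a:]" by (metis degree_0_id)
    then show ?thesis using False by (simp add: in_var_const num_monomials_def)
  qed
  have "num_monomials (summand C i0) \<le> (\<Prod>j<n. num_monomials (in_var j (h i0 j)))"
    unfolding summand[OF i0] by (rule num_monomials_prod)
  also have "\<dots> \<le> (\<Prod>j<n. if j \<in> act then s else 1)"
    using factor by (intro prod_mono) auto
  also have "\<dots> = s ^ card act"
    by (subst prod.inter_restrict[symmetric]) (auto simp: act_def Int_def intro!: arg_cong[of _ _ "\<lambda>A. s ^ card A"])
  also have "\<dots> \<le> s ^ (5 * k\<^sup>2)"
    using act assms(3) by (intro power_increasing) auto
  finally show "num_monomials (summand C i0) \<le> s ^ (5 * k\<^sup>2)" .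
qed

end
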